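(* Let $B$ be a unital algebra over $\mathbb{C}$ and $B\langle X\rangle=B*_{\mathbb{C}}\mathbb{C}\langle X\rangle$. Then $$\ker(\delta_{X:B})=B+[B\langle X\rangle,B\langle X\rangle]=\ker(C).$$
   Context: $B*_{\mathbb{C}}\mathbb{C}\langle X\rangle$ is the algebraic free product (amalgamated over $\mathbb{C}1$) of $B$ and the polynomial algebra in one indeterminate $X$; it is spanned by monomials $b_0Xb_1X\cdots Xb_n$ with $n\ge0$, $b_i\in B$. The free difference quotient $\partial_{X:B}:B\langle X\rangle\to B\langle X\rangle\otimes B\langle X\rangle$ is the derivation with $\partial_{X:B}[X]=1\otimes1$ and $\partial_{X:B}[b]=0$ for $b\in B$, i.e. $\partial_{X:B}[b_0Xb_1\cdots Xb_n]=\sum_{i=1}^{n}b_0X\cdots Xb_{i-1}\otimes b_iX\cdots Xb_n$. The cyclic derivative is $\delta_{X:B}=\mu\circ\sigma\circ\partial_{X:B}:B\langle X\rangle\to B\langle X\rangle$ with $\sigma(p\otimes q)=q\otimes p$ and $\mu(p\otimes q)=pq$. The $B$-symmetrization operator $C:B\langle X\rangle\to B\langle X\rangle$ is $C[p]=\delta_{X:B}[p]\,X$, i.e. $C[b_0Xb_1\cdots Xb_n]=\sum_{i=0}^{n-1}b_{i+1}X\cdots Xb_nb_0X\cdots Xb_iX$. $[B\langle X\rangle,B\langle X\rangle]$ denotes the linear span of all commutators $pq-qp$. *)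

theory Defs
  imports Complex_Main "HOL-Computational_Algebra.Polynomial"
begin

section \<open>Complex vector spaces and unital complex algebras\<close>

class scaleC =
  fixes scaleC :: "complex \<Rightarrow> 'a \<Rightarrow> 'a"  (infixr \<open>*\<^sub>C\<close> 75)

class complex_vector = scaleC + ab_group_add +
  assumes scaleC_add_right: "a *\<^sub>C (x + y) = a *\<^sub>C x + a *\<^sub>C y"
    and scaleC_add_left: "(a + b) *\<^sub>C x = a *\<^sub>C x + b *\<^sub>C x"
    and scaleC_scaleC: "a *\<^sub>C (b *\<^sub>C x) = (a * b) *\<^sub>C x"
    and scaleC_one: "1 *\<^sub>C x = x"

text \<open>
  The class is built on \<^class>\<open>monoid_mult\<close> and not on \<^class>\<open>ring_1\<close>, since the latter
  requires \<open>0 \<noteq> 1\<close> and would exclude the zero algebra.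
\<close>

class complex_unital_algebra = complex_vector + ring + monoid_mult +
  assumes mult_scaleC_left: "(a *\<^sub>C x) * y = a *\<^sub>C (x * y)"
    and mult_scaleC_right: "x * (a *\<^sub>C y) = a *\<^sub>C (x * y)"

global_interpretation complex_vector:
  vector_space "scaleC :: complex \<Rightarrow> 'a \<Rightarrow> 'a :: complex_vector"
  by unfold_locales (simp_all add: scaleC_add_right scaleC_add_left scaleC_scaleC scaleC_one)

abbreviation complex_linear :: "('a::complex_vector \<Rightarrow> 'b::complex_vector) \<Rightarrow> bool"
  where "complex_linear \<equiv> Vector_Spaces.linear scaleC scaleC"

lemma complex_linearI:
  fixes f :: "'a::complex_vector \<Rightarrow> 'b::complex_vector"
  assumes "\<And>x y. f (x + y) = f x + f y" "\<And>c x. f (c *\<^sub>C x) = c *\<^sub>C f x"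
  shows "complex_linear f"
  unfolding module_hom_iff_linear[symmetric]
  by unfold_locales (simp_all add: assms)

definition complex_bilinear ::
    "('a::complex_vector \<Rightarrow> 'b::complex_vector \<Rightarrow> 'c::complex_vector) \<Rightarrow> bool"
  where "complex_bilinear f \<longleftrightarrow>
    (\<forall>a. complex_linear (\<lambda>b. f a b)) \<and> (\<forall>b. complex_linear (\<lambda>a. f a b))"

lemma complex_bilinearI:
  fixes f :: "'a::complex_vector \<Rightarrow> 'b::complex_vector \<Rightarrow> 'c::complex_vector"
  assumes "\<And>a a' b. f (a + a') b = f a b + f a' b" "\<And>a b b'. f a (b + b') = f a b + f a b'"
    "\<And>c a b. f (c *\<^sub>C a) b = c *\<^sub>C f a b" "\<And>c a b. f a (c *\<^sub>C b) = c *\<^sub>C f a b"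
  shows "complex_bilinear f"
  unfolding complex_bilinear_def by (auto intro!: complex_linearI simp: assms)

lemma complex_bilinearD:
  fixes f :: "'a::complex_vector \<Rightarrow> 'b::complex_vector \<Rightarrow> 'c::complex_vector"
  assumes "complex_bilinear f"
  shows "f (a + a') b = f a b + f a' b" "f a (b + b') = f a b + f a b'"
    "f (c *\<^sub>C a) b = c *\<^sub>C f a b" "f a (c *\<^sub>C b) = c *\<^sub>C f a b"
  using assms unfolding complex_bilinear_def Vector_Spaces.linear_iff by auto

text \<open>
  The scalar actions are parameters, so that the polynomial algebra can occur as a source
  (with \<^term>\<open>smult\<close> as its scalar action).
\<close>

definition unital_algebra_hom ::
    "(complex \<Rightarrow> 'a \<Rightarrow> 'a) \<Rightarrow> (complex \<Rightarrow> 'b \<Rightarrow> 'b) \<Rightarrow> ('a::{ring,monoid_mult} \<Rightarrow> 'b::{ring,monoid_mult}) \<Rightarrow> bool"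
  where "unital_algebra_hom s1 s2 f \<longleftrightarrow>
    Vector_Spaces.linear s1 s2 f \<and> f 1 = 1 \<and> (\<forall>x y. f (x * y) = f x * f y)"


section \<open>The algebraic tensor product over the complex numbers\<close>

text \<open>
  Formal expressions in the symbols \<open>a \<otimes> b\<close>, modulo the least congruence that makes them a
  complex vector space (with \<open>0 \<otimes> 0\<close> as its zero) and \<open>\<otimes>\<close> bilinear.  The universal property
  is \<open>tensor_universal\<close> below.
\<close>

datatype ('a, 'b) tensor_term =
    TPure 'a 'b
  | TAdd "('a, 'b) tensor_term" "('a, 'b) tensor_term"
  | TScale complex "('a, 'b) tensor_term"

inductive tensor_rel ::
    "('a::complex_vector, 'b::complex_vector) tensor_term \<Rightarrow> ('a, 'b) tensor_term \<Rightarrow> bool"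
where
  tensor_refl: "tensor_rel s s"
| tensor_sym: "tensor_rel s t \<Longrightarrow> tensor_rel t s"
| tensor_trans: "tensor_rel s t \<Longrightarrow> tensor_rel t u \<Longrightarrow> tensor_rel s u"
| tensor_cong_add: "tensor_rel s s' \<Longrightarrow> tensor_rel t t' \<Longrightarrow> tensor_rel (TAdd s t) (TAdd s' t')"
| tensor_cong_scale: "tensor_rel s s' \<Longrightarrow> tensor_rel (TScale c s) (TScale c s')"
| tensor_add_assoc: "tensor_rel (TAdd (TAdd s t) u) (TAdd s (TAdd t u))"
| tensor_add_comm: "tensor_rel (TAdd s t) (TAdd t s)"
| tensor_add_zero: "tensor_rel (TAdd (TPure 0 0) s) s"
| tensor_add_minus: "tensor_rel (TAdd (TScale (-1) s) s) (TPure 0 0)"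
| tensor_scale_add_right: "tensor_rel (TScale c (TAdd s t)) (TAdd (TScale c s) (TScale c t))"
| tensor_scale_add_left: "tensor_rel (TScale (c + d) s) (TAdd (TScale c s) (TScale d s))"
| tensor_scale_scale: "tensor_rel (TScale c (TScale d s)) (TScale (c * d) s)"
| tensor_scale_one: "tensor_rel (TScale 1 s) s"
| tensor_pure_add_left: "tensor_rel (TPure (a + a') b) (TAdd (TPure a b) (TPure a' b))"
| tensor_pure_add_right: "tensor_rel (TPure a (b + b')) (TAdd (TPure a b) (TPure a b'))"
| tensor_pure_scale_left: "tensor_rel (TPure (c *\<^sub>C a) b) (TScale c (TPure a b))"
| tensor_pure_scale_right: "tensor_rel (TPure a (c *\<^sub>C b)) (TScale c (TPure a b))"

lemma equivp_tensor_rel: "equivp tensor_rel"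
  by (intro equivpI reflpI sympI transpI) (fact tensor_rel.tensor_refl, erule tensor_rel.tensor_sym, erule (1) tensor_rel.tensor_trans)

quotient_type (overloaded) ('a, 'b) tensor =
  "('a::complex_vector, 'b::complex_vector) tensor_term" / tensor_rel
  by (rule equivp_tensor_rel)

lift_definition tensor_pure :: "'a::complex_vector \<Rightarrow> 'b::complex_vector \<Rightarrow> ('a, 'b) tensor"
    (infixl \<open>\<otimes>\<close> 72)
  is TPure .

instantiation tensor :: (complex_vector, complex_vector) complex_vector
begin

lift_definition zero_tensor :: "('a, 'b) tensor" is "TPure 0 0" .

lift_definition plus_tensor :: "('a, 'b) tensor \<Rightarrow> ('a, 'b) tensor \<Rightarrow> ('a, 'b) tensor" is TAdd
  by (rule tensor_rel.tensor_cong_add)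

lift_definition scaleC_tensor :: "complex \<Rightarrow> ('a, 'b) tensor \<Rightarrow> ('a, 'b) tensor" is TScale
  by (rule tensor_rel.tensor_cong_scale)

lift_definition uminus_tensor :: "('a, 'b) tensor \<Rightarrow> ('a, 'b) tensor" is "TScale (-1)"
  by (rule tensor_rel.tensor_cong_scale)

definition minus_tensor :: "('a, 'b) tensor \<Rightarrow> ('a, 'b) tensor \<Rightarrow> ('a, 'b) tensor"
  where "minus_tensor s t = s + - t"

instance
proof
  fix r s t :: "('a, 'b) tensor" and c d :: complex
  show "r + s + t = r + (s + t)" by transfer (rule tensor_rel.tensor_add_assoc)
  show "r + s = s + r" by transfer (rule tensor_rel.tensor_add_comm)
  show "0 + r = r" by transfer (rule tensor_rel.tensor_add_zero)
  show "- r + r = 0" by transfer (rule tensor_rel.tensor_add_minus)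
  show "r - s = r + - s" by (rule minus_tensor_def)
  show "c *\<^sub>C (r + s) = c *\<^sub>C r + c *\<^sub>C s" by transfer (rule tensor_rel.tensor_scale_add_right)
  show "(c + d) *\<^sub>C r = c *\<^sub>C r + d *\<^sub>C r" by transfer (rule tensor_rel.tensor_scale_add_left)
  show "c *\<^sub>C (d *\<^sub>C r) = (c * d) *\<^sub>C r" by transfer (rule tensor_rel.tensor_scale_scale)
  show "1 *\<^sub>C r = r" by transfer (rule tensor_rel.tensor_scale_one)
qed

end

lemma bilinear_tensor_pure: "complex_bilinear (\<otimes>)"
  by (intro complex_bilinearI; transfer)
     (rule tensor_rel.tensor_pure_add_left tensor_rel.tensor_pure_add_right
        tensor_rel.tensor_pure_scale_left tensor_rel.tensor_pure_scale_right)+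

lemma tensor_induct [case_names pure add scale]:
  assumes "\<And>a b. P (a \<otimes> b)" "\<And>s t. P s \<Longrightarrow> P t \<Longrightarrow> P (s + t)" "\<And>c s. P s \<Longrightarrow> P (c *\<^sub>C s)"
  shows "P t"
proof (induction t rule: tensor.abs_induct)
  case (1 y)
  show ?case
  proof (induction y)
    case (TPure a b)
    then show ?case using assms(1) by (metis tensor_pure.abs_eq)
  next
    case (TAdd y1 y2)
    then show ?case using assms(2) by (metis plus_tensor.abs_eq)
  next
    case (TScale c y)
    then show ?case using assms(3) by (metis scaleC_tensor.abs_eq)
  qed
qed

primrec tensor_term_lift ::
    "('a \<Rightarrow> 'b \<Rightarrow> 'c::complex_vector) \<Rightarrow> ('a, 'b) tensor_term \<Rightarrow> 'c"
where
  "tensor_term_lift f (TPure a b) = f a b"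
| "tensor_term_lift f (TAdd s t) = tensor_term_lift f s + tensor_term_lift f t"
| "tensor_term_lift f (TScale c s) = c *\<^sub>C tensor_term_lift f s"

text \<open>
  For bilinear \<open>f\<close> this does not depend on the representative.
\<close>

definition tensor_lift ::
    "('a::complex_vector \<Rightarrow> 'b::complex_vector \<Rightarrow> 'c::complex_vector) \<Rightarrow> ('a, 'b) tensor \<Rightarrow> 'c"
  where "tensor_lift f t = tensor_term_lift f (rep_tensor t)"

lemma tensor_term_lift_cong:
  assumes "complex_bilinear f" "tensor_rel s t"
  shows "tensor_term_lift f s = tensor_term_lift f t"
  using assms(2)
proof induction
  case (tensor_add_zero s)
  have "f 0 0 = 0" using complex_bilinearD(3)[OF assms(1), of 0 0 0] by simp
  then show ?case by simp
next
  case (tensor_add_minus s)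
  have "f 0 0 = 0" using complex_bilinearD(3)[OF assms(1), of 0 0 0] by simp
  then show ?case by simp
qed (simp_all add: complex_bilinearD[OF assms(1)] scaleC_add_right scaleC_add_left add_ac)

lemma tensor_lift_abs:
  assumes "complex_bilinear f"
  shows "tensor_lift f (abs_tensor t) = tensor_term_lift f t"
  unfolding tensor_lift_def
  by (rule tensor_term_lift_cong[OF assms]) (rule tensor.abs_eq_iff[THEN iffD1, OF Quotient3_abs_rep[OF Quotient3_tensor]])

lemma tensor_lift_pure:
  assumes "complex_bilinear f"
  shows "tensor_lift f (a \<otimes> b) = f a b"
  unfolding tensor_pure.abs_eq tensor_lift_abs[OF assms] by simp

lemma tensor_lift_add:
  assumes "complex_bilinear f"
  shows "tensor_lift f (s + t) = tensor_lift f s + tensor_lift f t"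
  by (induction s rule: tensor.abs_induct, induction t rule: tensor.abs_induct)
     (simp add: plus_tensor.abs_eq tensor_lift_abs[OF assms])

lemma tensor_lift_scaleC:
  assumes "complex_bilinear f"
  shows "tensor_lift f (c *\<^sub>C s) = c *\<^sub>C tensor_lift f s"
  by (induction s rule: tensor.abs_induct)
     (simp add: scaleC_tensor.abs_eq tensor_lift_abs[OF assms])

lemma linear_tensor_lift: "complex_bilinear f \<Longrightarrow> complex_linear (tensor_lift f)"
  by (intro complex_linearI tensor_lift_add tensor_lift_scaleC)

theorem tensor_universal:
  fixes f :: "'a::complex_vector \<Rightarrow> 'b::complex_vector \<Rightarrow> 'c::complex_vector"
  assumes "complex_bilinear f"
  shows "\<exists>!F. complex_linear F \<and> (\<forall>a b. F (a \<otimes> b) = f a b)"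
proof (rule ex1I[of _ "tensor_lift f"])
  show "complex_linear (tensor_lift f) \<and> (\<forall>a b. tensor_lift f (a \<otimes> b) = f a b)"
    using assms by (simp add: linear_tensor_lift tensor_lift_pure)
next
  fix F assume F: "complex_linear F \<and> (\<forall>a b. F (a \<otimes> b) = f a b)"
  show "F = tensor_lift f"
  proof
    fix t show "F t = tensor_lift f t"
      using F by (induction t rule: tensor_induct)
        (simp_all add: Vector_Spaces.linear_iff tensor_lift_pure tensor_lift_add
          tensor_lift_scaleC assms)
  qed
qed


section \<open>The algebra \<open>B\<langle>X\<rangle>\<close>\<close>

text \<open>
  The free product of \<open>B\<close> and the polynomial algebra in one indeterminate, amalgamated over
  the scalars: expressions in the elements of \<open>B\<close> and a symbol \<open>X\<close>, modulo the least
  congruence that makes them a unital complex algebra and \<open>NCConst\<close> a homomorphism of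
  unital complex algebras.  The zero and the unit are those of \<open>B\<close>.  The universal property
  is \<open>ncpoly_free_product\<close> below.
\<close>

datatype 'b ncterm =
    NCConst 'b
  | NCVar
  | NCAdd "'b ncterm" "'b ncterm"
  | NCScale complex "'b ncterm"
  | NCMult "'b ncterm" "'b ncterm"

inductive ncrel :: "'b::complex_unital_algebra ncterm \<Rightarrow> 'b ncterm \<Rightarrow> bool"
where
  nc_refl: "ncrel s s"
| nc_sym: "ncrel s t \<Longrightarrow> ncrel t s"
| nc_trans: "ncrel s t \<Longrightarrow> ncrel t u \<Longrightarrow> ncrel s u"
| nc_cong_add: "ncrel s s' \<Longrightarrow> ncrel t t' \<Longrightarrow> ncrel (NCAdd s t) (NCAdd s' t')"
| nc_cong_scale: "ncrel s s' \<Longrightarrow> ncrel (NCScale c s) (NCScale c s')"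
| nc_cong_mult: "ncrel s s' \<Longrightarrow> ncrel t t' \<Longrightarrow> ncrel (NCMult s t) (NCMult s' t')"
| nc_add_assoc: "ncrel (NCAdd (NCAdd s t) u) (NCAdd s (NCAdd t u))"
| nc_add_comm: "ncrel (NCAdd s t) (NCAdd t s)"
| nc_add_zero: "ncrel (NCAdd (NCConst 0) s) s"
| nc_add_minus: "ncrel (NCAdd (NCScale (-1) s) s) (NCConst 0)"
| nc_scale_add_right: "ncrel (NCScale c (NCAdd s t)) (NCAdd (NCScale c s) (NCScale c t))"
| nc_scale_add_left: "ncrel (NCScale (c + d) s) (NCAdd (NCScale c s) (NCScale d s))"
| nc_scale_scale: "ncrel (NCScale c (NCScale d s)) (NCScale (c * d) s)"
| nc_scale_one: "ncrel (NCScale 1 s) s"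
| nc_mult_assoc: "ncrel (NCMult (NCMult s t) u) (NCMult s (NCMult t u))"
| nc_mult_one_left: "ncrel (NCMult (NCConst 1) s) s"
| nc_mult_one_right: "ncrel (NCMult s (NCConst 1)) s"
| nc_distrib_right: "ncrel (NCMult (NCAdd s t) u) (NCAdd (NCMult s u) (NCMult t u))"
| nc_distrib_left: "ncrel (NCMult s (NCAdd t u)) (NCAdd (NCMult s t) (NCMult s u))"
| nc_mult_scale_left: "ncrel (NCMult (NCScale c s) t) (NCScale c (NCMult s t))"
| nc_mult_scale_right: "ncrel (NCMult s (NCScale c t)) (NCScale c (NCMult s t))"
| nc_const_add: "ncrel (NCConst (a + b)) (NCAdd (NCConst a) (NCConst b))"
| nc_const_scale: "ncrel (NCConst (c *\<^sub>C a)) (NCScale c (NCConst a))"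
| nc_const_mult: "ncrel (NCConst (a * b)) (NCMult (NCConst a) (NCConst b))"

lemma equivp_ncrel: "equivp ncrel"
  by (intro equivpI reflpI sympI transpI) (fact ncrel.nc_refl, erule ncrel.nc_sym, erule (1) ncrel.nc_trans)

quotient_type (overloaded) 'b ncpoly = "'b::complex_unital_algebra ncterm" / ncrel
  by (rule equivp_ncrel)

lift_definition nc_const :: "'b::complex_unital_algebra \<Rightarrow> 'b ncpoly" is NCConst .

lift_definition nc_X :: "'b::complex_unital_algebra ncpoly" is NCVar .

instantiation ncpoly :: (complex_unital_algebra) complex_unital_algebra
begin

lift_definition zero_ncpoly :: "'a ncpoly" is "NCConst 0" .

lift_definition one_ncpoly :: "'a ncpoly" is "NCConst 1" .

lift_definition plus_ncpoly :: "'a ncpoly \<Rightarrow> 'a ncpoly \<Rightarrow> 'a ncpoly" is NCAdd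
  by (rule ncrel.nc_cong_add)

lift_definition times_ncpoly :: "'a ncpoly \<Rightarrow> 'a ncpoly \<Rightarrow> 'a ncpoly" is NCMult
  by (rule ncrel.nc_cong_mult)

lift_definition scaleC_ncpoly :: "complex \<Rightarrow> 'a ncpoly \<Rightarrow> 'a ncpoly" is NCScale
  by (rule ncrel.nc_cong_scale)

lift_definition uminus_ncpoly :: "'a ncpoly \<Rightarrow> 'a ncpoly" is "NCScale (-1)"
  by (rule ncrel.nc_cong_scale)

definition minus_ncpoly :: "'a ncpoly \<Rightarrow> 'a ncpoly \<Rightarrow> 'a ncpoly"
  where "minus_ncpoly p q = p + - q"

instance
proof
  fix p q r :: "'a ncpoly" and c d :: complex
  show "p + q + r = p + (q + r)" by transfer (rule ncrel.nc_add_assoc)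
  show "p + q = q + p" by transfer (rule ncrel.nc_add_comm)
  show "0 + p = p" by transfer (rule ncrel.nc_add_zero)
  show "- p + p = 0" by transfer (rule ncrel.nc_add_minus)
  show "p - q = p + - q" by (rule minus_ncpoly_def)
  show "c *\<^sub>C (p + q) = c *\<^sub>C p + c *\<^sub>C q" by transfer (rule ncrel.nc_scale_add_right)
  show "(c + d) *\<^sub>C p = c *\<^sub>C p + d *\<^sub>C p" by transfer (rule ncrel.nc_scale_add_left)
  show "c *\<^sub>C (d *\<^sub>C p) = (c * d) *\<^sub>C p" by transfer (rule ncrel.nc_scale_scale)
  show "1 *\<^sub>C p = p" by transfer (rule ncrel.nc_scale_one)
  show "p * q * r = p * (q * r)" by transfer (rule ncrel.nc_mult_assoc)
  show "1 * p = p" by transfer (rule ncrel.nc_mult_one_left)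
  show "p * 1 = p" by transfer (rule ncrel.nc_mult_one_right)
  show "(p + q) * r = p * r + q * r" by transfer (rule ncrel.nc_distrib_right)
  show "p * (q + r) = p * q + p * r" by transfer (rule ncrel.nc_distrib_left)
  show "(c *\<^sub>C p) * q = c *\<^sub>C (p * q)" by transfer (rule ncrel.nc_mult_scale_left)
  show "p * (c *\<^sub>C q) = c *\<^sub>C (p * q)" by transfer (rule ncrel.nc_mult_scale_right)
qed

end

lemma nc_const_hom: "unital_algebra_hom scaleC scaleC nc_const"
  unfolding unital_algebra_hom_def
  by (intro conjI allI complex_linearI; transfer)
     (rule ncrel.nc_const_add ncrel.nc_const_scale ncrel.nc_const_mult ncrel.nc_refl)+

lemma ncpoly_induct [case_names const X add scale mult]:
  assumes "\<And>b. P (nc_const b)" "P nc_X" "\<And>p q. P p \<Longrightarrow> P q \<Longrightarrow> P (p + q)"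
    "\<And>c p. P p \<Longrightarrow> P (c *\<^sub>C p)" "\<And>p q. P p \<Longrightarrow> P q \<Longrightarrow> P (p * q)"
  shows "P p"
proof (induction p rule: ncpoly.abs_induct)
  case (1 y)
  show ?case
  proof (induction y)
    case (NCConst b)
    then show ?case using assms(1) by (metis nc_const.abs_eq)
  next
    case NCVar
    then show ?case using assms(2) by (metis nc_X.abs_eq)
  next
    case (NCAdd y1 y2)
    then show ?case using assms(3) by (metis plus_ncpoly.abs_eq)
  next
    case (NCScale c y)
    then show ?case using assms(4) by (metis scaleC_ncpoly.abs_eq)
  next
    case (NCMult y1 y2)
    then show ?case using assms(5) by (metis times_ncpoly.abs_eq)
  qed
qed

primrec ncterm_eval ::
    "('b \<Rightarrow> 'a::complex_unital_algebra) \<Rightarrow> 'a \<Rightarrow> 'b ncterm \<Rightarrow> 'a"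
where
  "ncterm_eval f x (NCConst b) = f b"
| "ncterm_eval f x NCVar = x"
| "ncterm_eval f x (NCAdd s t) = ncterm_eval f x s + ncterm_eval f x t"
| "ncterm_eval f x (NCScale c s) = c *\<^sub>C ncterm_eval f x s"
| "ncterm_eval f x (NCMult s t) = ncterm_eval f x s * ncterm_eval f x t"

lemma ncterm_eval_cong:
  fixes f :: "'b::complex_unital_algebra \<Rightarrow> 'a::complex_unital_algebra"
  assumes "unital_algebra_hom scaleC scaleC f" "ncrel s t"
  shows "ncterm_eval f x s = ncterm_eval f x t"
proof -
  have f: "f (a + b) = f a + f b" "f (c *\<^sub>C a) = c *\<^sub>C f a" "f 1 = 1" "f (a * b) = f a * f b"
    for a b c
    using assms(1) unfolding unital_algebra_hom_def Vector_Spaces.linear_iff by auto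
  have f0: "f 0 = 0" using f(2)[of 0 0] by simp
  show ?thesis using assms(2)
    by induction
      (simp_all add: f f0 scaleC_add_right scaleC_add_left mult_scaleC_left mult_scaleC_right
        distrib_left distrib_right mult.assoc add_ac)
qed

lemma unital_algebra_homD:
  fixes f :: "'b::{ring,monoid_mult} \<Rightarrow> 'a::{ring,monoid_mult}"
  assumes "unital_algebra_hom s1 s2 f"
  shows "f (a + b) = f a + f b" "f (s1 c a) = s2 c (f a)" "f 1 = 1" "f (a * b) = f a * f b"
  using assms unfolding unital_algebra_hom_def Vector_Spaces.linear_iff by auto

theorem ncpoly_universal:
  fixes f :: "'b::complex_unital_algebra \<Rightarrow> 'a::complex_unital_algebra"
  assumes f: "unital_algebra_hom scaleC scaleC f"
  shows "\<exists>!F. unital_algebra_hom scaleC scaleC F \<and> (\<forall>b. F (nc_const b) = f b) \<and> F nc_X = x"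
proof -
  define F where "F p = ncterm_eval f x (rep_ncpoly p)" for p
  have abs: "F (abs_ncpoly t) = ncterm_eval f x t" for t
    unfolding F_def
    by (rule ncterm_eval_cong[OF f]) (rule ncpoly.abs_eq_iff[THEN iffD1, OF Quotient3_abs_rep[OF Quotient3_ncpoly]])
  have add: "F (p + q) = F p + F q" for p q
    by (induction p rule: ncpoly.abs_induct, induction q rule: ncpoly.abs_induct)
       (simp add: abs plus_ncpoly.abs_eq)
  have scale: "F (c *\<^sub>C p) = c *\<^sub>C F p" for c p
    by (induction p rule: ncpoly.abs_induct) (simp add: abs scaleC_ncpoly.abs_eq)
  have mult: "F (p * q) = F p * F q" for p q
    by (induction p rule: ncpoly.abs_induct, induction q rule: ncpoly.abs_induct)
       (simp add: abs times_ncpoly.abs_eq)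
  have const: "F (nc_const b) = f b" for b
    by (simp add: nc_const.abs_eq abs)
  have one: "F 1 = 1"
    using unital_algebra_homD(3)[OF f] by (simp add: one_ncpoly.abs_eq abs)
  have X: "F nc_X = x" by (simp add: nc_X.abs_eq abs)
  show ?thesis
  proof (rule ex1I[of _ F])
    show "unital_algebra_hom scaleC scaleC F \<and> (\<forall>b. F (nc_const b) = f b) \<and> F nc_X = x"
      unfolding unital_algebra_hom_def
      by (simp add: add scale mult const one X complex_linearI)
  next
    fix G
    assume G: "unital_algebra_hom scaleC scaleC G \<and> (\<forall>b. G (nc_const b) = f b) \<and> G nc_X = x"
    note G' = unital_algebra_homD[OF conjunct1[OF G]]
    show "G = F"
    proof
      fix p show "G p = F p"
        using G by (induction p rule: ncpoly_induct) (simp_all add: G' add scale mult const X)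
    qed
  qed
qed

definition nc_of_poly :: "complex poly \<Rightarrow> 'b::complex_unital_algebra ncpoly"
  where "nc_of_poly q = (\<Sum>i\<le>degree q. coeff q i *\<^sub>C nc_X ^ i)"

lemma nc_of_poly_bound:
  assumes "degree q \<le> n"
  shows "nc_of_poly q = (\<Sum>i\<le>n. coeff q i *\<^sub>C nc_X ^ i)"
  unfolding nc_of_poly_def
  by (rule sum.mono_neutral_left) (use assms in \<open>auto simp: coeff_eq_0\<close>)

lemma nc_of_poly_add: "nc_of_poly (p + q) = nc_of_poly p + nc_of_poly q"
proof -
  define n where "n = max (degree p) (degree q)"
  have "degree p \<le> n" "degree q \<le> n" "degree (p + q) \<le> n"
    by (auto simp: n_def degree_add_le)
  then show ?thesis
    by (simp add: nc_of_poly_bound[of _ n] scaleC_add_left sum.distrib)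
qed

lemma nc_of_poly_smult: "nc_of_poly (smult c p) = c *\<^sub>C nc_of_poly p"
  by (simp add: nc_of_poly_bound[OF degree_smult_le] nc_of_poly_bound[OF order_refl]
      complex_vector.scale_sum_right)

lemma nc_of_poly_pCons: "nc_of_poly (pCons c p) = c *\<^sub>C 1 + nc_X * nc_of_poly p"
  by (simp add: nc_of_poly_bound[OF degree_pCons_le] nc_of_poly_bound[of p "degree p"]
      sum.atMost_Suc_shift sum_distrib_left mult_scaleC_right del: sum.atMost_Suc)

lemma nc_of_poly_0: "nc_of_poly 0 = 0"
  by (simp add: nc_of_poly_def)

lemma nc_of_poly_mult: "nc_of_poly (p * q) = nc_of_poly p * nc_of_poly q"
  by (induction p)
     (simp_all add: nc_of_poly_0 nc_of_poly_pCons nc_of_poly_add nc_of_poly_smult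
       distrib_right mult_scaleC_left mult.assoc)

lemma nc_of_poly_1: "nc_of_poly 1 = 1"
  by (simp add: nc_of_poly_def)

lemma nc_of_poly_X: "nc_of_poly [:0, 1:] = nc_X"
  by (simp add: nc_of_poly_pCons nc_of_poly_0)

lemma nc_of_poly_hom: "unital_algebra_hom smult scaleC nc_of_poly"
  unfolding unital_algebra_hom_def module_hom_iff_linear[symmetric]
  by (intro conjI allI; unfold_locales?)
     (simp_all add: nc_of_poly_add nc_of_poly_smult nc_of_poly_mult nc_of_poly_1
       smult_add_right smult_add_left)

theorem ncpoly_free_product:
  fixes f :: "'b::complex_unital_algebra \<Rightarrow> 'a::complex_unital_algebra"
    and g :: "complex poly \<Rightarrow> 'a"
  assumes f: "unital_algebra_hom scaleC scaleC f" and g: "unital_algebra_hom smult scaleC g"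
  shows "\<exists>!F. unital_algebra_hom scaleC scaleC F \<and>
    (\<forall>b. F (nc_const b) = f b) \<and> (\<forall>q. F (nc_of_poly q) = g q)"
proof -
  note g' = unital_algebra_homD[OF g]
  define x where "x = g [:0, 1:]"
  have g0: "g 0 = 0" using g'(2)[of 0 0] by simp
  have gp: "g (pCons c p) = c *\<^sub>C 1 + x * g p" for c p
  proof -
    have "pCons c p = smult c 1 + [:0, 1:] * p" by simp
    then show ?thesis unfolding x_def by (metis g'(1-4))
  qed
  have eq: "(\<forall>q. F (nc_of_poly q) = g q) \<longleftrightarrow> F nc_X = x"
    if F: "unital_algebra_hom scaleC scaleC F" for F :: "'b ncpoly \<Rightarrow> 'a"
  proof
    assume "\<forall>q. F (nc_of_poly q) = g q"
    then show "F nc_X = x" unfolding x_def by (metis nc_of_poly_X)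
  next
    note F' = unital_algebra_homD[OF F]
    have F0: "F 0 = 0" using F'(2)[of 0 0] by simp
    assume X: "F nc_X = x"
    show "\<forall>q. F (nc_of_poly q) = g q"
    proof
      fix q show "F (nc_of_poly q) = g q"
        by (induction q) (simp_all add: nc_of_poly_0 g0 F0 nc_of_poly_pCons F' X gp)
    qed
  qed
  show ?thesis using ncpoly_universal[OF f, of x] eq by metis
qed


section \<open>Free difference quotient, cyclic derivative, symmetrization\<close>

definition tensor_lmult ::
    "'a::complex_unital_algebra \<Rightarrow> ('a, 'a) tensor \<Rightarrow> ('a, 'a) tensor"
  where "tensor_lmult p = tensor_lift (\<lambda>a b. (p * a) \<otimes> b)"

definition tensor_rmult ::
    "('a, 'a) tensor \<Rightarrow> 'a::complex_unital_algebra \<Rightarrow> ('a, 'a) tensor"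
  where "tensor_rmult t q = tensor_lift (\<lambda>a b. a \<otimes> (b * q)) t"

definition tensor_flip :: "('a::complex_vector, 'b::complex_vector) tensor \<Rightarrow> ('b, 'a) tensor"
  where "tensor_flip = tensor_lift (\<lambda>a b. b \<otimes> a)"

definition tensor_mult :: "('a::complex_unital_algebra, 'a) tensor \<Rightarrow> 'a"
  where "tensor_mult = tensor_lift (*)"

lemmas tensor_pure_simps = complex_bilinearD[OF bilinear_tensor_pure]

lemma bilinear_lmult: "complex_bilinear (\<lambda>a b. ((p :: 'a::complex_unital_algebra) * a) \<otimes> b)"
  by (rule complex_bilinearI) (simp_all add: tensor_pure_simps distrib_left mult_scaleC_right)

lemma bilinear_rmult: "complex_bilinear (\<lambda>a b. a \<otimes> (b * (q :: 'a::complex_unital_algebra)))"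
  by (rule complex_bilinearI) (simp_all add: tensor_pure_simps distrib_right mult_scaleC_left)

lemma bilinear_flip: "complex_bilinear (\<lambda>a b. b \<otimes> a)"
  by (rule complex_bilinearI) (simp_all add: tensor_pure_simps)

lemma bilinear_mult: "complex_bilinear ((*) :: 'a::complex_unital_algebra \<Rightarrow> _)"
  by (rule complex_bilinearI)
     (simp_all add: distrib_left distrib_right mult_scaleC_left mult_scaleC_right)

lemmas tensor_flip_simps =
  tensor_lift_pure[OF bilinear_flip, folded tensor_flip_def]
  tensor_lift_add[OF bilinear_flip, folded tensor_flip_def]
  tensor_lift_scaleC[OF bilinear_flip, folded tensor_flip_def]

lemmas tensor_mult_simps =
  tensor_lift_pure[OF bilinear_mult, folded tensor_mult_def]
  tensor_lift_add[OF bilinear_mult, folded tensor_mult_def]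
  tensor_lift_scaleC[OF bilinear_mult, folded tensor_mult_def]

lemma tensor_lmult_simps:
  "tensor_lmult p (a \<otimes> b) = (p * a) \<otimes> b"
  "tensor_lmult p (s + t) = tensor_lmult p s + tensor_lmult p t"
  "tensor_lmult p (c *\<^sub>C t) = c *\<^sub>C tensor_lmult p t"
  unfolding tensor_lmult_def
  by (simp_all add: tensor_lift_pure tensor_lift_add tensor_lift_scaleC bilinear_lmult)

lemma tensor_rmult_simps:
  "tensor_rmult (a \<otimes> b) q = a \<otimes> (b * q)"
  "tensor_rmult (s + t) q = tensor_rmult s q + tensor_rmult t q"
  "tensor_rmult (c *\<^sub>C t) q = c *\<^sub>C tensor_rmult t q"
  unfolding tensor_rmult_def
  by (simp_all add: tensor_lift_pure tensor_lift_add tensor_lift_scaleC bilinear_rmult)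

lemma tensor_lmult_alg:
  "tensor_lmult (p + q) t = tensor_lmult p t + tensor_lmult q t"
  "tensor_lmult (c *\<^sub>C p) t = c *\<^sub>C tensor_lmult p t"
  "tensor_lmult (p * q) t = tensor_lmult p (tensor_lmult q t)"
  "tensor_lmult 1 t = t"
  by (induction t rule: tensor_induct;
      simp add: tensor_lmult_simps tensor_pure_simps distrib_right mult_scaleC_left mult.assoc
        scaleC_add_right scaleC_scaleC mult.commute[of c] add_ac)+

lemma tensor_rmult_alg:
  "tensor_rmult t (p + q) = tensor_rmult t p + tensor_rmult t q"
  "tensor_rmult t (c *\<^sub>C p) = c *\<^sub>C tensor_rmult t p"
  "tensor_rmult t (p * q) = tensor_rmult (tensor_rmult t p) q"
  "tensor_rmult t 1 = t"
  by (induction t rule: tensor_induct;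
      simp add: tensor_rmult_simps tensor_pure_simps distrib_left mult_scaleC_right mult.assoc
        scaleC_add_right scaleC_scaleC mult.commute[of c] add_ac)+

lemma tensor_lmult_rmult:
  "tensor_lmult p (tensor_rmult t q) = tensor_rmult (tensor_lmult p t) q"
  by (induction t rule: tensor_induct) (simp_all add: tensor_lmult_simps tensor_rmult_simps)

lemma tensor_lmult_0: "tensor_lmult p 0 = 0"
  using tensor_lmult_simps(3)[of p "0 :: complex" 0] by simp

lemma tensor_rmult_0: "tensor_rmult 0 q = 0"
  using tensor_rmult_simps(3)[where c = 0 and t = 0 and q = q] by simp

primrec ncterm_diff :: "'b::complex_unital_algebra ncterm \<Rightarrow> ('b ncpoly, 'b ncpoly) tensor"
where
  "ncterm_diff (NCConst b) = 0"
| "ncterm_diff NCVar = 1 \<otimes> 1"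
| "ncterm_diff (NCAdd s t) = ncterm_diff s + ncterm_diff t"
| "ncterm_diff (NCScale c s) = c *\<^sub>C ncterm_diff s"
| "ncterm_diff (NCMult s t) =
     tensor_rmult (ncterm_diff s) (abs_ncpoly t) + tensor_lmult (abs_ncpoly s) (ncterm_diff t)"

lift_definition free_diff_quotient ::
    "'b::complex_unital_algebra ncpoly \<Rightarrow> ('b ncpoly, 'b ncpoly) tensor"
  is ncterm_diff
proof -
  fix s t :: "'b ncterm"
  assume "ncrel s t"
  then show "ncterm_diff s = ncterm_diff t"
  proof induction
    case (nc_cong_mult s s' t t')
    then have "abs_ncpoly s = abs_ncpoly s'" "abs_ncpoly t = abs_ncpoly t'"
      by (simp_all add: ncpoly.abs_eq_iff)
    with nc_cong_mult show ?case by simp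
  qed (simp_all add: scaleC_add_right scaleC_add_left tensor_lmult_0 tensor_rmult_0
      tensor_lmult_simps(2-) tensor_rmult_simps(2-) tensor_lmult_alg tensor_rmult_alg
      tensor_lmult_rmult plus_ncpoly.abs_eq[symmetric] times_ncpoly.abs_eq[symmetric]
      scaleC_ncpoly.abs_eq[symmetric] one_ncpoly.abs_eq[symmetric] add_ac)
qed

lemma free_diff_quotient_simps:
  "free_diff_quotient (nc_const b) = 0"
  "free_diff_quotient nc_X = 1 \<otimes> 1"
  "free_diff_quotient (p + q) = free_diff_quotient p + free_diff_quotient q"
  "free_diff_quotient (c *\<^sub>C p) = c *\<^sub>C free_diff_quotient p"
  by (transfer; simp)+

lemma free_diff_quotient_mult:
  "free_diff_quotient (p * q) =
    tensor_rmult (free_diff_quotient p) q + tensor_lmult p (free_diff_quotient q)"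
  by (induction p rule: ncpoly.abs_induct, induction q rule: ncpoly.abs_induct)
     (simp add: free_diff_quotient.abs_eq times_ncpoly.abs_eq)

theorem free_diff_quotient_unique:
  "D = free_diff_quotient \<longleftrightarrow>
    complex_linear D \<and> (\<forall>p q. D (p * q) = tensor_rmult (D p) q + tensor_lmult p (D q)) \<and>
    D nc_X = 1 \<otimes> 1 \<and> (\<forall>b. D (nc_const b) = 0)" (is "_ \<longleftrightarrow> ?R")
proof
  assume "D = free_diff_quotient"
  then show ?R
    by (simp add: free_diff_quotient_simps free_diff_quotient_mult complex_linearI)
next
  assume R: ?R
  show "D = free_diff_quotient"
  proof
    fix p show "D p = free_diff_quotient p"
      using R by (induction p rule: ncpoly_induct)
        (simp_all add: Vector_Spaces.linear_iff free_diff_quotient_simps free_diff_quotient_mult)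
  qed
qed

definition cyclic_derivative :: "'b::complex_unital_algebra ncpoly \<Rightarrow> 'b ncpoly"
  where "cyclic_derivative = tensor_mult \<circ> tensor_flip \<circ> free_diff_quotient"

definition symmetrization :: "'b::complex_unital_algebra ncpoly \<Rightarrow> 'b ncpoly"
  where "symmetrization p = cyclic_derivative p * nc_X"

definition commutator_span :: "'a::complex_unital_algebra set"
  where "commutator_span = complex_vector.span {p * q - q * p | p q. True}"

end

theory Submission
  imports Defs
begin

text \<open>
  The cyclic derivative kills constants, and it kills commutators because \<open>\<delta>(pq)\<close> is symmetric
  in \<open>p\<close> and \<open>q\<close>.  Since \<open>C[p] = \<delta>[p] X\<close>, what remains is \<open>ker C \<subseteq> B + [B\<langle>X\<rangle>, B\<langle>X\<rangle>]\<close>.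

  Let \<open>N\<close> be the number operator, the derivation with \<open>N X = X\<close> and \<open>N b = 0\<close>, which
  multiplies a monomial with \<open>n\<close> factors \<open>X\<close> by \<open>n\<close>.  It arises from \<open>\<partial>\<close> by sending \<open>a \<otimes> b\<close> to
  \<open>a X b\<close>, while \<open>C\<close> arises by sending \<open>a \<otimes> b\<close> to \<open>b a X\<close>.  These differ by the commutator of \<open>b\<close>
  and \<open>a X\<close>, so \<open>C p\<close> and \<open>N p\<close> agree modulo commutators
  (\<open>symmetrization_minus_number_operator\<close>).  Hence \<open>C p = 0\<close> puts \<open>N p\<close> in the commutator span.

  Every \<open>p\<close> is a sum of a constant and of eigenvectors of \<open>N\<close> for eigenvalues
  \<open>1, \<dots>, d\<close> (\<open>homogeneous_decomposition\<close>).  As a derivation, \<open>N\<close> preserves the commutator span,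
  and a subspace invariant under \<open>N\<close> contains with a sum of eigenvectors for distinct eigenvalues
  each of the summands (\<open>eigenvectors_in_invariant_subspace\<close>).  So \<open>n p\<^sub>n\<close>, and
  therefore \<open>p\<^sub>n\<close> for \<open>n \<ge> 1\<close>, is a sum of commutators.
\<close>

section \<open>Eigenvectors and invariant subspaces\<close>

global_interpretation complex_vector_pair: vector_space_pair
    "scaleC :: complex \<Rightarrow> 'a \<Rightarrow> 'a :: complex_vector"
    "scaleC :: complex \<Rightarrow> 'b \<Rightarrow> 'b :: complex_vector"
  by unfold_locales

lemma eigenvectors_in_invariant_subspace:
  fixes T :: "'a::complex_vector \<Rightarrow> 'a"
  assumes T: "complex_linear T" and V: "complex_vector.subspace V"
    and inv: "\<And>v. v \<in> V \<Longrightarrow> T v \<in> V"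
    and eig: "\<And>n. T (f n) = of_nat n *\<^sub>C f n"
    and sum: "(\<Sum>n\<le>d. f n) \<in> V" and n: "n \<le> d"
  shows "f n \<in> V"
  using eig sum n
proof (induction d arbitrary: f n)
  case 0
  then show ?case by simp
next
  case (Suc d)
  note T_simps = complex_vector_pair.linear_sum[OF T] complex_vector_pair.linear_scale[OF T]
  define c :: "nat \<Rightarrow> complex" where "c k = of_nat k - of_nat (Suc d)" for k
  \<comment> \<open>Applying \<open>T - (d + 1)\<close> removes the top summand and rescales the others by nonzero factors.\<close>
  have "T (\<Sum>k\<le>Suc d. f k) - of_nat (Suc d) *\<^sub>C (\<Sum>k\<le>Suc d. f k) = (\<Sum>k\<le>Suc d. c k *\<^sub>C f k)"
    by (simp only: T_simps Suc.prems(1) complex_vector.scale_sum_right c_def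
        complex_vector.scale_left_diff_distrib sum_subtractf)
  also have "\<dots> = (\<Sum>k\<le>d. c k *\<^sub>C f k)"
    by (simp add: c_def)
  finally have "(\<Sum>k\<le>d. c k *\<^sub>C f k) \<in> V"
    using Suc.prems(2) inv V
    by (metis complex_vector.subspace_diff complex_vector.subspace_scale)
  moreover have "T (c k *\<^sub>C f k) = of_nat k *\<^sub>C c k *\<^sub>C f k" for k
    by (simp add: T_simps Suc.prems(1) mult.commute)
  ultimately have "c k *\<^sub>C f k \<in> V" if "k \<le> d" for k
    using Suc.IH[of "\<lambda>k. c k *\<^sub>C f k"] that by blast
  moreover have "f k = inverse (c k) *\<^sub>C c k *\<^sub>C f k" if "k \<le> d" for k
  proof -
    have "c k \<noteq> 0"
      unfolding c_def right_minus_eq of_nat_eq_iff using that by simp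
    then show ?thesis by simp
  qed
  ultimately have low: "f k \<in> V" if "k \<le> d" for k
    using that complex_vector.subspace_scale[OF V] by metis
  have "f (Suc d) = (\<Sum>k\<le>Suc d. f k) - (\<Sum>k\<le>d. f k)" by simp
  also have "\<dots> \<in> V"
    by (intro complex_vector.subspace_diff complex_vector.subspace_sum V Suc.prems(2) low) auto
  finally show ?case using low Suc.prems(3) le_Suc_eq by auto
qed

section \<open>Commutators and the cyclic derivative\<close>

lemma subspace_commutator_span: "complex_vector.subspace commutator_span"
  unfolding commutator_span_def by (rule complex_vector.subspace_span)

lemma commutator_in_span: "p * q - q * p \<in> commutator_span"
  unfolding commutator_span_def by (intro complex_vector.span_base) blast

lemma cyclic_derivative_eq:
  "cyclic_derivative p = tensor_mult (tensor_flip (free_diff_quotient p))"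
  by (simp add: cyclic_derivative_def)

lemma linear_cyclic_derivative: "complex_linear cyclic_derivative"
  by (rule complex_linearI)
     (simp_all add: cyclic_derivative_eq free_diff_quotient_simps tensor_flip_simps
       tensor_mult_simps)

lemma cyclic_derivative_nc_const: "cyclic_derivative (nc_const b) = 0"
  by (simp add: cyclic_derivative_eq free_diff_quotient_simps tensor_flip_def tensor_mult_def
      complex_vector_pair.linear_0[OF linear_tensor_lift[OF bilinear_flip]]
      complex_vector_pair.linear_0[OF linear_tensor_lift[OF bilinear_mult]])

text \<open>
  Multiplying after the flip turns the right action on one tensor factor into the left action on
  the other, which makes both halves of the product rule cyclically symmetric.
\<close>

lemma mult_flip_rmult_eq_lmult:
  "tensor_mult (tensor_flip (tensor_rmult t q)) = tensor_mult (tensor_flip (tensor_lmult q t))"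
  by (induction t rule: tensor_induct)
     (simp_all add: tensor_lmult_simps tensor_rmult_simps tensor_flip_simps tensor_mult_simps
       mult.assoc)

lemma cyclic_derivative_mult_commute: "cyclic_derivative (p * q) = cyclic_derivative (q * p)"
  by (simp add: cyclic_derivative_eq free_diff_quotient_mult tensor_flip_simps tensor_mult_simps
      mult_flip_rmult_eq_lmult add.commute)

lemma cyclic_derivative_commutator_span:
  assumes "q \<in> commutator_span"
  shows "cyclic_derivative q = 0"
  using assms unfolding commutator_span_def
  by (induction rule: complex_vector.span_induct)
     (auto intro!: complex_vector_pair.linear_subspace_kernel[OF linear_cyclic_derivative]
       simp: complex_vector_pair.linear_diff[OF linear_cyclic_derivative] cyclic_derivative_mult_commute)

section \<open>The number operator\<close>

text \<open>
  The linear map that puts \<open>X\<close> in the place of the tensor sign.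
\<close>

definition fill_X :: "('b::complex_unital_algebra ncpoly, 'b ncpoly) tensor \<Rightarrow> 'b ncpoly"
  where "fill_X = tensor_lift (\<lambda>a b. a * nc_X * b)"

text \<open>
  The derivation of \<open>B\<langle>X\<rangle>\<close> that counts the occurrences of \<open>X\<close>: the free difference quotient
  removes each occurrence in turn, and \<^const>\<open>fill_X\<close> puts it back.
\<close>

definition number_operator :: "'b::complex_unital_algebra ncpoly \<Rightarrow> 'b ncpoly"
  where "number_operator p = fill_X (free_diff_quotient p)"

lemma bilinear_fill_X: "complex_bilinear (\<lambda>a b. a * nc_X * b)"
  by (rule complex_bilinearI)
     (simp_all add: distrib_left distrib_right mult_scaleC_left mult_scaleC_right)

lemmas fill_X_simps =
  tensor_lift_pure[OF bilinear_fill_X, folded fill_X_def]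
  tensor_lift_add[OF bilinear_fill_X, folded fill_X_def]
  tensor_lift_scaleC[OF bilinear_fill_X, folded fill_X_def]

lemma linear_number_operator: "complex_linear number_operator"
  by (rule complex_linearI)
     (simp_all add: number_operator_def free_diff_quotient_simps fill_X_simps)

lemmas number_operator_linear_simps =
  complex_vector_pair.linear_add[OF linear_number_operator]
  complex_vector_pair.linear_diff[OF linear_number_operator]
  complex_vector_pair.linear_scale[OF linear_number_operator]
  complex_vector_pair.linear_sum[OF linear_number_operator]
  complex_vector_pair.linear_0[OF linear_number_operator]

lemma number_operator_X: "number_operator nc_X = nc_X"
  by (simp add: number_operator_def free_diff_quotient_simps fill_X_simps)

lemma number_operator_nc_const: "number_operator (nc_const b) = 0"
  using complex_vector_pair.linear_0[OF linear_tensor_lift[OF bilinear_fill_X]]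
  by (simp add: number_operator_def free_diff_quotient_simps fill_X_def)

lemma number_operator_mult:
  "number_operator (p * q) = number_operator p * q + p * number_operator q"
proof -
  have "fill_X (tensor_rmult t q) = fill_X t * q" for t
    by (induction t rule: tensor_induct)
       (simp_all add: tensor_rmult_simps fill_X_simps distrib_right mult_scaleC_left mult.assoc)
  moreover have "fill_X (tensor_lmult p t) = p * fill_X t" for t
    by (induction t rule: tensor_induct)
       (simp_all add: tensor_lmult_simps fill_X_simps distrib_left mult_scaleC_right mult.assoc)
  ultimately show ?thesis
    by (simp add: number_operator_def free_diff_quotient_mult fill_X_simps)
qed

lemma number_operator_commutator_span:
  assumes "v \<in> commutator_span"
  shows "number_operator v \<in> commutator_span"
proof -
  have "number_operator (p * q - q * p) \<in> commutator_span" for p q :: "'a ncpoly"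
  proof -
    have "number_operator (p * q - q * p) =
        (number_operator p * q - q * number_operator p) +
        (p * number_operator q - number_operator q * p)"
      by (simp add: number_operator_linear_simps number_operator_mult algebra_simps)
    then show ?thesis
      by (simp add: complex_vector.subspace_add subspace_commutator_span commutator_in_span)
  qed
  moreover have "complex_vector.subspace {v. number_operator v \<in> commutator_span}"
    using complex_vector_pair.linear_subspace_vimage[OF linear_number_operator subspace_commutator_span]
    by (simp add: vimage_def)
  ultimately have "v \<in> {v. number_operator v \<in> commutator_span}"
    by (intro complex_vector.span_subspace_induct[OF assms[unfolded commutator_span_def]]) auto
  then show ?thesis by simp
qed

lemma symmetrization_minus_number_operator:
  "symmetrization p - number_operator p \<in> commutator_span"
proof -
  have "tensor_mult (tensor_flip t) * nc_X - fill_X t \<in> commutator_span"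
    for t :: "('a ncpoly, 'a ncpoly) tensor"
  proof (induction t rule: tensor_induct)
    case (pure a b)
    then show ?case
      using commutator_in_span[of b "a * nc_X"]
      by (simp add: tensor_flip_simps tensor_mult_simps fill_X_simps mult.assoc)
  next
    case (add s t)
    then show ?case
      using complex_vector.subspace_add[OF subspace_commutator_span add.IH]
      by (simp add: tensor_flip_simps tensor_mult_simps fill_X_simps algebra_simps)
  next
    case (scale c s)
    then show ?case
      using complex_vector.subspace_scale[OF subspace_commutator_span scale.IH, of c]
      by (simp add: tensor_flip_simps tensor_mult_simps fill_X_simps mult_scaleC_left
          complex_vector.scale_right_diff_distrib)
  qed
  then show ?thesis
    by (simp add: symmetrization_def cyclic_derivative_eq number_operator_def)
qed

section \<open>Homogeneous decomposition\<close>

text \<open>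
  The polynomial \<open>p\<close> is a finite sum of eigenvectors of the number operator, where the
  component of degree \<open>0\<close> is required to be a constant.
\<close>

definition decomposable :: "'b::complex_unital_algebra ncpoly \<Rightarrow> bool"
  where "decomposable p \<longleftrightarrow> (\<exists>f d. p = (\<Sum>n\<le>d. f n) \<and> f 0 \<in> range nc_const \<and>
    (\<forall>n. number_operator (f n) = of_nat n *\<^sub>C f n))"

lemma nc_const_0: "nc_const 0 = 0"
  by (simp add: nc_const.abs_eq zero_ncpoly.abs_eq)

lemma decomposable_nc_const: "decomposable (nc_const b)"
  unfolding decomposable_def
  by (rule exI[of _ "\<lambda>n. if n = 0 then nc_const b else 0"], rule exI[of _ 0])
     (simp add: number_operator_nc_const number_operator_linear_simps)

lemma decomposable_add:
  assumes "decomposable p" "decomposable q"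
  shows "decomposable (p + q)"
proof -
  obtain f d where f: "p = (\<Sum>n\<le>d. f n)" "f 0 \<in> range nc_const"
      "\<And>n. number_operator (f n) = of_nat n *\<^sub>C f n"
    using assms(1) unfolding decomposable_def by blast
  obtain g e where g: "q = (\<Sum>n\<le>e. g n)" "g 0 \<in> range nc_const"
      "\<And>n. number_operator (g n) = of_nat n *\<^sub>C g n"
    using assms(2) unfolding decomposable_def by blast
  define h where "h n = (if n \<le> d then f n else 0) + (if n \<le> e then g n else 0)" for n
  have "(\<Sum>n\<le>max d e. if n \<le> d then f n else 0) = p"
    unfolding f(1) by (rule sum.mono_neutral_cong_right) auto
  moreover have "(\<Sum>n\<le>max d e. if n \<le> e then g n else 0) = q"
    unfolding g(1) by (rule sum.mono_neutral_cong_right) auto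
  ultimately have "p + q = (\<Sum>n\<le>max d e. h n)"
    by (simp add: h_def sum.distrib)
  moreover have "h 0 \<in> range nc_const"
    using f(2) g(2) by (auto simp: h_def unital_algebra_homD(1)[OF nc_const_hom, symmetric])
  moreover have "\<forall>n. number_operator (h n) = of_nat n *\<^sub>C h n"
    by (simp add: h_def number_operator_linear_simps f(3) g(3) scaleC_add_right)
  ultimately show ?thesis
    unfolding decomposable_def by blast
qed

lemma decomposable_nc_const_mult:
  assumes "decomposable p"
  shows "decomposable (nc_const b * p)"
proof -
  obtain f d where f: "p = (\<Sum>n\<le>d. f n)" "f 0 \<in> range nc_const"
      "\<And>n. number_operator (f n) = of_nat n *\<^sub>C f n"
    using assms unfolding decomposable_def by blast
  have "nc_const b * p = (\<Sum>n\<le>d. nc_const b * f n)"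
    by (simp add: f(1) sum_distrib_left)
  moreover have "nc_const b * f 0 \<in> range nc_const"
    using f(2) by (auto simp: unital_algebra_homD(4)[OF nc_const_hom, symmetric])
  moreover have "\<forall>n. number_operator (nc_const b * f n) = of_nat n *\<^sub>C (nc_const b * f n)"
    by (simp add: number_operator_mult number_operator_nc_const f(3) mult_scaleC_right)
  ultimately show ?thesis
    unfolding decomposable_def by (intro exI[of _ "\<lambda>n. nc_const b * f n"] exI[of _ d]) simp
qed

lemma decomposable_X_mult:
  assumes "decomposable p"
  shows "decomposable (nc_X * p)"
proof -
  obtain f d where f: "p = (\<Sum>n\<le>d. f n)"
      "\<And>n. number_operator (f n) = of_nat n *\<^sub>C f n"
    using assms unfolding decomposable_def by blast
  define g where "g n = (case n of 0 \<Rightarrow> 0 | Suc m \<Rightarrow> nc_X * f m)" for n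
  have "nc_X * p = (\<Sum>n\<le>Suc d. g n)"
    by (simp add: f(1) sum_distrib_left sum.atMost_Suc_shift g_def del: sum.atMost_Suc)
  moreover have "g 0 \<in> range nc_const"
    by (simp add: g_def) (metis nc_const_0 rangeI)
  moreover have "number_operator (g n) = of_nat n *\<^sub>C g n" for n
    by (cases n)
       (simp_all add: g_def number_operator_linear_simps number_operator_mult number_operator_X
         f(2) mult_scaleC_right scaleC_add_left)
  ultimately show ?thesis
    unfolding decomposable_def by blast
qed

lemma homogeneous_decomposition: "decomposable p"
proof -
  \<comment> \<open>Inducting on a left factor makes the product case a matter of associativity.\<close>
  have "decomposable q \<Longrightarrow> decomposable (p * q)" for q
  proof (induction p arbitrary: q rule: ncpoly_induct)
    case (scale c p)
    have "(c *\<^sub>C p) * q = nc_const (c *\<^sub>C 1) * (p * q)"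
      by (metis mult_scaleC_left mult_1 unital_algebra_homD(2,3)[OF nc_const_hom])
    then show ?case
      using scale by (simp add: decomposable_nc_const_mult)
  qed (simp_all add: decomposable_nc_const_mult decomposable_X_mult decomposable_add
      distrib_right mult.assoc)
  from this[of 1] show ?thesis
    using decomposable_nc_const[of 1] by (simp add: unital_algebra_homD(3)[OF nc_const_hom])
qed

section \<open>The kernels of the cyclic derivative and of the symmetrization\<close>

lemma const_plus_commutators_if_number_operator_in_span:
  assumes "number_operator p \<in> commutator_span"
  shows "\<exists>b. \<exists>q\<in>commutator_span. p = nc_const b + q"
proof -
  obtain f d where f: "p = (\<Sum>n\<le>d. f n)" "f 0 \<in> range nc_const"
      "\<And>n. number_operator (f n) = of_nat n *\<^sub>C f n"
    using homogeneous_decomposition[of p] unfolding decomposable_def by blast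
  have sum: "(\<Sum>n\<le>d. of_nat n *\<^sub>C f n) \<in> commutator_span"
    using assms by (simp add: f(1,3) number_operator_linear_simps)
  have scaled: "of_nat n *\<^sub>C f n \<in> commutator_span" if "n \<le> d" for n
    by (rule eigenvectors_in_invariant_subspace[OF linear_number_operator subspace_commutator_span
          number_operator_commutator_span _ sum that])
       (simp_all add: number_operator_linear_simps f(3))
  have "f n \<in> commutator_span" if "n \<in> {1..d}" for n
    using complex_vector.subspace_scale[OF subspace_commutator_span scaled, of n "inverse (of_nat n)"]
      that by simp
  then have "(\<Sum>n\<in>{1..d}. f n) \<in> commutator_span"
    by (rule complex_vector.subspace_sum[OF subspace_commutator_span])
  moreover have "p = f 0 + (\<Sum>n\<in>{1..d}. f n)"
    by (simp add: f(1) atMost_atLeast0 sum.atLeast_Suc_atMost)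
  moreover obtain b where "f 0 = nc_const b"
    using f(2) by blast
  ultimately show ?thesis by auto
qed

theorem theorem8p3:
  shows "{p :: 'b::complex_unital_algebra ncpoly. cyclic_derivative p = 0}
           = {nc_const b + q | (b :: 'b) q. q \<in> commutator_span}
       \<and> {nc_const b + q | (b :: 'b) q. q \<in> commutator_span}
           = {p :: 'b ncpoly. symmetrization p = 0}"
proof -
  have "cyclic_derivative (nc_const b + q) = 0" if "q \<in> commutator_span" for b :: 'b and q
    using that
    by (simp add: complex_vector_pair.linear_add[OF linear_cyclic_derivative] cyclic_derivative_nc_const
        cyclic_derivative_commutator_span)
  moreover have "symmetrization p = 0" if "cyclic_derivative p = 0" for p :: "'b ncpoly"
    using that by (simp add: symmetrization_def)
  moreover have "\<exists>b. \<exists>q\<in>commutator_span. p = nc_const b + q" if "symmetrization p = 0"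
    for p :: "'b ncpoly"
  proof -
    have "- number_operator p \<in> commutator_span"
      using symmetrization_minus_number_operator[of p] that by simp
    then have "number_operator p \<in> commutator_span"
      using complex_vector.subspace_neg[OF subspace_commutator_span] by fastforce
    then show ?thesis
      by (rule const_plus_commutators_if_number_operator_in_span)
  qed
  ultimately show ?thesis
    by blast
qed

end
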